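(* Let $k\ge 2$ and $l\ge1$ be integers and let $G$ be a graph that admits an oriented $k$-cycle $2l$-cover. Then: (1) $\phi_{d,p}(G)=2$ for every $p\in[1,\infty]$, where $d=k-1$; (2) if $l=1$, then $\phi_{d,1}(G)=2$, where $d=\lceil k/2\rceil$.
   Context: All graphs are finite and may have multiple edges but no loops. A cycle is a subgraph in which every vertex has even degree; a cycle in a directed graph is directed if every vertex has equal in- and out-degree. An oriented $k$-cycle $2l$-cover of $G$ is a family of $k$ directed cycles (each a cycle of $G$ with an orientation of its edges making it directed) such that each edge of $G$ is covered exactly $2l$ times, $l$ times in each direction. For an orientation $D$ and vertex $v$, $E_D^+(v)$, $E_D^-(v)$ are the out- and in-edges. For $\Omega\subseteq\mathbb{R}^d$, a vector $\Omega$-flow of $G$ is $(D,f)$ with $f:E(G)\to\Omega$ and $\sum_{e\in E_D^+(v)}f(e)-\sum_{e\in E_D^-(v)}f(e)=\mathbf{0}$ at every vertex. $\|x\|_p$ is the usual $p$-norm, $\|x\|_\infty=\max_i|x_i|$. For integer $d\ge1$, real $r\ge2$, $p\in[1,\infty]$, an $(r,d,p)$-NZF is a vector $(\mathbb{R}^d\setminus\{\mathbf{0}\})$-flow with $1\le\|f(e)\|_p\le r-1$ for all edges. For a bridgeless graph $G$, $\phi_{d,p}(G)$ is the infimum of real $r$ such that $G$ admits an $(r,d,p)$-NZF. *)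

theory Defs
  imports
    "Graph_Theory.Digraph"
    "Jordan_Normal_Form.Matrix"
    "HOL-Library.Extended_Real"
begin

text \<open>
  Undirected multigraphs. Each edge is an abstract object carrying a two-element set of
  end vertices, so that parallel edges are possible and loops are not.
\<close>

record ('v, 'e) mgraph =
  nodes :: "'v set"
  edges :: "'e set"
  ends :: "'e \<Rightarrow> 'v set"

locale fin_mgraph =
  fixes G :: "('v, 'e) mgraph"
  assumes finite_nodes: "finite (nodes G)"
    and finite_edges: "finite (edges G)"
    and ends_in_nodes: "e \<in> edges G \<Longrightarrow> ends G e \<subseteq> nodes G"
    and card_ends: "e \<in> edges G \<Longrightarrow> card (ends G e) = 2"

definition mdegree :: "('v, 'e) mgraph \<Rightarrow> 'v \<Rightarrow> nat" where
  "mdegree G v = card {e \<in> edges G. v \<in> ends G e}"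

definition is_subgraph :: "('v, 'e) mgraph \<Rightarrow> ('v, 'e) mgraph \<Rightarrow> bool" where
  "is_subgraph H G \<longleftrightarrow> fin_mgraph H \<and> fin_mgraph G \<and>
     nodes H \<subseteq> nodes G \<and> edges H \<subseteq> edges G \<and> (\<forall>e\<in>edges H. ends H e = ends G e)"

definition is_cycle :: "('v, 'e) mgraph \<Rightarrow> ('v, 'e) mgraph \<Rightarrow> bool" where
  "is_cycle G H \<longleftrightarrow> is_subgraph H G \<and> (\<forall>v\<in>nodes H. even (mdegree H v))"

definition is_orientation :: "('v, 'e) mgraph \<Rightarrow> ('v, 'e) pre_digraph \<Rightarrow> bool" where
  "is_orientation G D \<longleftrightarrow> verts D = nodes G \<and> arcs D = edges G \<and>
     (\<forall>e\<in>edges G. {tail D e, head D e} = ends G e)"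

definition is_directed_cycle :: "('v, 'e) mgraph \<Rightarrow> ('v, 'e) pre_digraph \<Rightarrow> bool" where
  "is_directed_cycle G C \<longleftrightarrow>
     (\<exists>H. is_cycle G H \<and> is_orientation H C) \<and>
     (\<forall>v\<in>verts C. in_degree C v = out_degree C v)"

text \<open>
  The directed cycles of the family are indexed by the numbers below k; the same cycle may
  occur several times. Traversing an edge in one of its two directions is the same as leaving
  from one of its two ends.
\<close>

definition oriented_cycle_cover ::
  "('v, 'e) mgraph \<Rightarrow> nat \<Rightarrow> nat \<Rightarrow> (nat \<Rightarrow> ('v, 'e) pre_digraph) \<Rightarrow> bool" where
  "oriented_cycle_cover G k l C \<longleftrightarrow>
     (\<forall>i<k. is_directed_cycle G (C i)) \<and>
     (\<forall>e\<in>edges G.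
        card {i. i < k \<and> e \<in> arcs (C i)} = 2 * l \<and>
        (\<forall>v\<in>ends G e. card {i. i < k \<and> e \<in> arcs (C i) \<and> tail (C i) e = v} = l))"

definition admits_oriented_cycle_cover :: "('v, 'e) mgraph \<Rightarrow> nat \<Rightarrow> nat \<Rightarrow> bool" where
  "admits_oriented_cycle_cover G k l \<longleftrightarrow> (\<exists>C. oriented_cycle_cover G k l C)"

definition vector_flow ::
  "('v, 'e) mgraph \<Rightarrow> nat \<Rightarrow> real vec set \<Rightarrow> ('v, 'e) pre_digraph \<Rightarrow> ('e \<Rightarrow> real vec) \<Rightarrow> bool" where
  "vector_flow G d \<Omega> D f \<longleftrightarrow>
     \<Omega> \<subseteq> carrier_vec d \<and> is_orientation G D \<and> (\<forall>e\<in>edges G. f e \<in> \<Omega>) \<and>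
     (\<forall>v\<in>nodes G.
        finsum_vec TYPE(real) d f (out_arcs D v) - finsum_vec TYPE(real) d f (in_arcs D v)
          = 0\<^sub>v d)"

text \<open>
  Only meant for exponents p with 1 \<open>\<le>\<close> p \<open>\<le>\<close> \<open>\<infinity>\<close> and vectors of positive dimension.
\<close>

definition pnorm :: "ereal \<Rightarrow> real vec \<Rightarrow> real" where
  "pnorm p x =
     (if p = \<infinity> then Max ((\<lambda>i. \<bar>x $ i\<bar>) ` {..<dim_vec x})
      else (\<Sum>i<dim_vec x. \<bar>x $ i\<bar> powr real_of_ereal p) powr (1 / real_of_ereal p))"

definition is_NZF ::
  "('v, 'e) mgraph \<Rightarrow> real \<Rightarrow> nat \<Rightarrow> ereal \<Rightarrow> ('v, 'e) pre_digraph \<Rightarrow> ('e \<Rightarrow> real vec) \<Rightarrow> bool" where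
  "is_NZF G r d p D f \<longleftrightarrow>
     d \<ge> 1 \<and> r \<ge> 2 \<and> p \<ge> 1 \<and>
     vector_flow G d (carrier_vec d - {0\<^sub>v d}) D f \<and>
     (\<forall>e\<in>edges G. 1 \<le> pnorm p (f e) \<and> pnorm p (f e) \<le> r - 1)"

text \<open>
  The infimum is taken in the extended reals, so that it is \<open>\<infinity>\<close> if no admissible r exists (as
  happens for graphs with a bridge); for real-valued Inf the value would be unspecified.
\<close>

definition phi :: "nat \<Rightarrow> ereal \<Rightarrow> ('v, 'e) mgraph \<Rightarrow> ereal" where
  "phi d p G = (INF r \<in> {r. \<exists>D f. is_NZF G r d p D f}. ereal r)"

end

(*
  Write every directed cycle of the cover as a flow with values in {-1, 0, 1}. The vector x of
  these k values at an edge has l entries 1, l entries -1 and zeros otherwise. It remains to find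
  a linear map from R^k to R^d that sends all such x to vectors of norm 1.
  (1) For p = \<infinity> drop the last coordinate. For finite p the first k - 1 coordinates of x have
  p-norm (2l)^(1/p) whenever the last coordinate is 0; adding c times the last coordinate to each
  of the others does not affect these x, and by the intermediate value theorem c can be chosen
  such that the remaining x get the same norm.
  (2) For l = 1 every x is a difference of two unit vectors, so a map sending the k unit vectors
  to vertices of the cross-polytope, which are equidistant in the 1-norm, does it.
*)
theory Submission
  imports Defs
begin

section \<open>Sign vectors with equally many entries 1 and -1\<close>

definition balanced :: "nat \<Rightarrow> nat \<Rightarrow> (nat \<Rightarrow> real) \<Rightarrow> bool" where
  "balanced k l x \<longleftrightarrow> (\<forall>i<k. x i \<in> {-1, 0, 1}) \<and>
     card {i. i < k \<and> x i = 1} = l \<and> card {i. i < k \<and> x i = -1} = l"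

lemma balanced_sum:
  assumes "balanced k l x"
  shows "(\<Sum>i<k. g (x i)) = real l * g 1 + real l * g (-1) + (real k - 2 * real l) * g (0::real)"
proof -
  let ?A = "{i. i < k \<and> x i = 1}" and ?B = "{i. i < k \<and> x i = -1}" and ?Z = "{i. i < k \<and> x i = 0}"
  have part: "{..<k} = (?A \<union> ?B) \<union> ?Z"
    using assms unfolding balanced_def by auto
  have dis: "?A \<inter> ?B = {}" "(?A \<union> ?B) \<inter> ?Z = {}" by auto
  have fin: "finite ?A" "finite ?B" "finite ?Z" by auto
  have split: "(\<Sum>i<k. h i) = (\<Sum>i\<in>?A. h i) + (\<Sum>i\<in>?B. h i) + (\<Sum>i\<in>?Z. h i)" for h :: "nat \<Rightarrow> real"
    unfolding part using fin dis by (simp add: sum.union_disjoint)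
  \<comment> \<open>Splitting the sum of the constant 1 shows that there are k - 2l zeros.\<close>
  have "real k = real l + real l + real (card ?Z)"
    using split[of "\<lambda>_. 1"] assms by (simp add: balanced_def)
  then show ?thesis
    unfolding split using assms by (simp add: balanced_def)
qed

lemma balanced_le:
  assumes "balanced k l x"
  shows "2 * l \<le> k"
proof -
  have "card ({i. i < k \<and> x i = 1} \<union> {i. i < k \<and> x i = -1}) \<le> card {..<k}"
    by (rule card_mono) auto
  also have "card ({i. i < k \<and> x i = 1} \<union> {i. i < k \<and> x i = -1}) = 2 * l"
    using assms unfolding balanced_def by (subst card_Un_disjoint) auto
  finally show ?thesis by simp
qed

section \<open>Directed cycles as flows with values in {-1, 0, 1}\<close>

definition edge_sign :: "('v, 'e) pre_digraph \<Rightarrow> ('v, 'e) pre_digraph \<Rightarrow> 'e \<Rightarrow> real" where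
  "edge_sign D C e = (if e \<in> arcs C then if tail C e = tail D e then 1 else -1 else 0)"

lemma orientation_exists:
  assumes "fin_mgraph G"
  shows "\<exists>D. is_orientation G D"
proof -
  have "\<exists>q. {fst q, snd q} = ends G e" if "e \<in> edges G" for e
    using fin_mgraph.card_ends[OF assms that] by (force simp: card_2_iff)
  then obtain q where "\<And>e. e \<in> edges G \<Longrightarrow> {fst (q e), snd (q e)} = ends G e"
    by metis
  then show ?thesis
    by (intro exI[of _ "\<lparr>verts = nodes G, arcs = edges G, tail = fst \<circ> q, head = snd \<circ> q\<rparr>"])
       (simp add: is_orientation_def)
qed

lemma directed_cycle_arcs:
  assumes "is_directed_cycle G C" "e \<in> arcs C"
  shows "e \<in> edges G" "{tail C e, head C e} = ends G e" "ends G e \<subseteq> verts C"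
  using assms fin_mgraph.ends_in_nodes
  by (fastforce simp: is_directed_cycle_def is_cycle_def is_subgraph_def is_orientation_def)+

text \<open>If \<open>C\<close> traverses an edge against \<open>D\<close>, the swap of its ends and
  the sign -1 cancel. So each edge contributes to the signed net outflow along \<open>D\<close> at
  \<open>v\<close> what it contributes to out-degree minus in-degree of \<open>C\<close> at
  \<open>v\<close>, and that difference is zero.\<close>

lemma edge_sign_conservation:
  assumes G: "fin_mgraph G" and D: "is_orientation G D" and C: "is_directed_cycle G C"
  shows "(\<Sum>e\<in>out_arcs D v. edge_sign D C e) = (\<Sum>e\<in>in_arcs D v. edge_sign D C e)"
proof -
  let ?x = "edge_sign D C"
  have finG: "finite (edges G)" and arcsD: "arcs D = edges G"
    using G D by (auto simp: fin_mgraph_def is_orientation_def)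
  have sub: "arcs C \<subseteq> edges G" using directed_cycle_arcs[OF C] by blast
  have fin: "finite (arcs C)" using sub finG finite_subset by blast
  have pt: "(if tail D e = v then ?x e else 0) - (if head D e = v then ?x e else 0)
      = (if e \<in> arcs C \<and> tail C e = v then 1 else 0) - (if e \<in> arcs C \<and> head C e = v then 1 else 0)"
    if e: "e \<in> edges G" for e
  proof (cases "e \<in> arcs C")
    case True
    have "{tail D e, head D e} = ends G e" using D e by (simp add: is_orientation_def)
    then have "{tail C e, head C e} = {tail D e, head D e}" "card {tail D e, head D e} = 2"
      using directed_cycle_arcs(2)[OF C True] fin_mgraph.card_ends[OF G e] by simp_all
    then have "tail C e = tail D e \<and> head C e = head D e \<or> tail C e = head D e \<and> head C e = tail D e"
      and "tail D e \<noteq> head D e"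
      by (auto simp: doubleton_eq_iff)
    with True show ?thesis by (auto simp: edge_sign_def)
  qed (simp add: edge_sign_def)
  have "(\<Sum>e\<in>out_arcs D v. ?x e) - (\<Sum>e\<in>in_arcs D v. ?x e)
      = (\<Sum>e\<in>edges G. (if tail D e = v then ?x e else 0) - (if head D e = v then ?x e else 0))"
    unfolding out_arcs_def in_arcs_def arcsD sum_subtractf
    using finG by (simp only: sum.inter_filter)
  also have "\<dots> = (\<Sum>e\<in>edges G. (if e \<in> arcs C \<and> tail C e = v then 1 else 0)
      - (if e \<in> arcs C \<and> head C e = v then 1 else 0))"
    using pt by (rule sum.cong[OF refl])
  also have "\<dots> = real (card {e\<in>edges G. e \<in> arcs C \<and> tail C e = v})
      - real (card {e\<in>edges G. e \<in> arcs C \<and> head C e = v})"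
    unfolding sum_subtractf sum.inter_filter[OF finG, symmetric] by simp
  also have "{e\<in>edges G. e \<in> arcs C \<and> tail C e = v} = out_arcs C v"
    using sub by (auto simp: out_arcs_def)
  also have "{e\<in>edges G. e \<in> arcs C \<and> head C e = v} = in_arcs C v"
    using sub by (auto simp: in_arcs_def)
  also have "card (out_arcs C v) = card (in_arcs C v)"
  proof (cases "v \<in> verts C")
    case True
    then show ?thesis using C by (simp add: is_directed_cycle_def in_degree_def out_degree_def)
  next
    \<comment> \<open>Degree balance is given only at the vertices of \<open>C\<close>; no arc of
      \<open>C\<close> meets any other vertex.\<close>
    case False
    then have "out_arcs C v = {}" "in_arcs C v = {}"
      using directed_cycle_arcs(2,3)[OF C] by (auto simp: out_arcs_def in_arcs_def)
    then show ?thesis by simp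
  qed
  finally show ?thesis by simp
qed

text \<open>The cover condition counts, for each end of \<open>e\<close>, the cycles that leave from
  it. Those leaving from \<open>tail D e\<close> are the ones of sign 1, those leaving from
  \<open>head D e\<close> the ones of sign -1.\<close>

lemma edge_sign_balanced:
  assumes G: "fin_mgraph G" and D: "is_orientation G D" and C: "oriented_cycle_cover G k l C"
    and e: "e \<in> edges G"
  shows "balanced k l (\<lambda>i. edge_sign D (C i) e)"
proof -
  have ends: "{tail D e, head D e} = ends G e" using D e by (simp add: is_orientation_def)
  then have ne: "tail D e \<noteq> head D e" using fin_mgraph.card_ends[OF G e] by (force simp flip: ends)
  have cov: "card {i. i < k \<and> e \<in> arcs (C i) \<and> tail (C i) e = v} = l" if "v \<in> ends G e" for v
    using C e that by (auto simp: oriented_cycle_cover_def)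
  have "tail (C i) e \<in> {tail D e, head D e}" if "i < k" "e \<in> arcs (C i)" for i
    using C that ends directed_cycle_arcs(2)[of G "C i" e] by (auto simp: oriented_cycle_cover_def)
  then have "{i. i < k \<and> edge_sign D (C i) e = -1} = {i. i < k \<and> e \<in> arcs (C i) \<and> tail (C i) e = head D e}"
    and "{i. i < k \<and> edge_sign D (C i) e = 1} = {i. i < k \<and> e \<in> arcs (C i) \<and> tail (C i) e = tail D e}"
    using ne by (auto simp: edge_sign_def)
  then show ?thesis
    using cov[of "tail D e"] cov[of "head D e"] ends
    by (auto simp: balanced_def edge_sign_def)
qed

section \<open>Reduction to a linear map from R^k to R^d\<close>

lemma pnorm_zero:
  assumes "d \<ge> 1"
  shows "pnorm p (0\<^sub>v d) = 0"
proof -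
  have "(\<lambda>i. \<bar>0\<^sub>v d $ i :: real\<bar>) ` {..<d} = {0}"
    using assms by (auto simp: image_iff intro!: exI[of _ 0])
  then show ?thesis by (simp add: pnorm_def)
qed

text \<open>Conservation is linear, so the matrix \<open>a\<close> turns the k scalar flows of the
  cycles into a vector flow; all its values have norm 1, so r = 2 is attained. No smaller r counts,
  since \<open>is_NZF\<close> demands r \<ge> 2.\<close>

lemma phi_eq_2:
  fixes a :: "nat \<Rightarrow> nat \<Rightarrow> real"
  assumes G: "fin_mgraph G" and C: "oriented_cycle_cover G k l C"
    and d: "d \<ge> 1" and p: "p \<ge> 1"
    and norm: "\<And>x. balanced k l x \<Longrightarrow> pnorm p (vec d (\<lambda>j. \<Sum>i<k. a j i * x i)) = 1"
  shows "phi d p G = 2"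
proof -
  obtain D where D: "is_orientation G D" using orientation_exists[OF G] by blast
  define f where "f e = vec d (\<lambda>j. \<Sum>i<k. a j i * edge_sign D (C i) e)" for e
  have n1: "pnorm p (f e) = 1" if "e \<in> edges G" for e
    unfolding f_def using norm edge_sign_balanced[OF G D C that] .
  have fd: "f e \<in> carrier_vec d" for e by (simp add: f_def)
  have fin: "finite (out_arcs D v)" "finite (in_arcs D v)" for v
    using G D by (auto simp: fin_mgraph_def is_orientation_def out_arcs_def in_arcs_def)
  have conserve: "finsum_vec TYPE(real) d f (out_arcs D v) - finsum_vec TYPE(real) d f (in_arcs D v) = 0\<^sub>v d"
    for v
  proof (rule eq_vecI)
    have car: "finsum_vec TYPE(real) d f (out_arcs D v) \<in> carrier_vec d"
      "finsum_vec TYPE(real) d f (in_arcs D v) \<in> carrier_vec d"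
      using fd by (auto intro!: finsum_vec_closed)
    then show "dim_vec (finsum_vec TYPE(real) d f (out_arcs D v) - finsum_vec TYPE(real) d f (in_arcs D v))
        = dim_vec (0\<^sub>v d :: real vec)"
      by simp
    fix j assume "j < dim_vec (0\<^sub>v d :: real vec)"
    then have j: "j < d" by simp
    have swap: "(\<Sum>e\<in>S. f e $ j) = (\<Sum>i<k. a j i * (\<Sum>e\<in>S. edge_sign D (C i) e))" for S
      using j unfolding f_def by (simp add: sum.swap[of _ S] sum_distrib_left)
    have "(\<Sum>e\<in>out_arcs D v. f e $ j) = (\<Sum>e\<in>in_arcs D v. f e $ j)"
      unfolding swap using C edge_sign_conservation[OF G D]
      by (intro sum.cong) (auto simp: oriented_cycle_cover_def)
    then show "(finsum_vec TYPE(real) d f (out_arcs D v) - finsum_vec TYPE(real) d f (in_arcs D v)) $ j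
        = 0\<^sub>v d $ j"
      using car j fin fd by (simp add: index_finsum_vec)
  qed
  \<comment> \<open>Norm 1 also excludes the zero vector, by \<open>pnorm_zero\<close>.\<close>
  have "is_NZF G 2 d p D f"
    unfolding is_NZF_def vector_flow_def
    using d p D fd n1 conserve pnorm_zero[OF d, of p] by force
  then have "phi d p G \<le> ereal 2"
    unfolding phi_def by (intro INF_lower) auto
  moreover have "ereal 2 \<le> phi d p G"
    unfolding phi_def by (intro INF_greatest) (auto simp: is_NZF_def)
  ultimately show ?thesis by simp
qed

section \<open>Dimension k - 1, all exponents\<close>

lemma shift_exists:
  fixes p :: real and k l :: nat
  assumes p: "p \<ge> 1" and l: "l \<ge> 1" and kl: "2 * l \<le> k"
  shows "\<exists>c::real. (real l - 1) * \<bar>1 + c\<bar> powr p + real l * \<bar>1 - c\<bar> powr p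
    + (real k - 2 * real l) * \<bar>c\<bar> powr p = 2 * real l"
proof -
  \<comment> \<open>Take a balanced vector with last entry 1 and add c to its other entries, which
    are l - 1 ones, l entries -1 and k - 2l zeros: \<open>?h c\<close> is the sum of the p-th powers
    of their absolute values.\<close>
  let ?h = "\<lambda>c::real. (real l - 1) * \<bar>1 + c\<bar> powr p + real l * \<bar>1 - c\<bar> powr p
    + (real k - 2 * real l) * \<bar>c\<bar> powr p"
  have "?h 0 \<le> 2 * real l" using p by simp
  \<comment> \<open>The point 3 is chosen for \<bar>1 - 3\<bar> = 2: the middle term alone is then l
    * 2 powr p \<ge> 2l.\<close>
  moreover have "2 * real l \<le> ?h 3"
  proof -
    have "2 powr 1 \<le> 2 powr p" using p by (intro powr_mono) auto
    then have "real l * 2 \<le> real l * 2 powr p" by (intro mult_left_mono) auto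
    moreover have "0 \<le> (real l - 1) * 4 powr p" "0 \<le> (real k - 2 * real l) * 3 powr p"
      using l kl by auto
    ultimately show ?thesis by simp
  qed
  moreover have "continuous_on {0..3} ?h"
    using p by (intro continuous_intros continuous_on_powr') auto
  ultimately show ?thesis
    using IVT'[of ?h 0 "2 * real l" 3] by auto
qed

text \<open>An entry 1 and an entry -1 sit at different positions, so dropping the last coordinate
  leaves at least one entry of absolute value 1.\<close>

lemma phi_cover_top:
  assumes G: "fin_mgraph G" and k: "k \<ge> 2" and l: "l \<ge> 1" and C: "oriented_cycle_cover G k l C"
  shows "phi (k - 1) \<infinity> G = 2"
proof (rule phi_eq_2[OF G C, where a = "\<lambda>j i. if i = j then 1 else 0"])
  fix x assume x: "balanced k l x"
  have vec: "vec (k - 1) (\<lambda>j. \<Sum>i<k. (if i = j then 1 else 0) * x i) = vec (k - 1) x"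
    by (intro eq_vecI) (auto simp: if_distrib[of "\<lambda>z. z * _"] cong: if_cong)
  have "card {i. i < k \<and> x i = 1} = l" "card {i. i < k \<and> x i = -1} = l"
    using x by (auto simp: balanced_def)
  then obtain u v where uv: "u < k" "x u = 1" "v < k" "x v = -1"
    using l by (metis (mono_tags, lifting) One_nat_def card.empty empty_Collect_eq not_one_le_zero)
  then have "u \<noteq> v" by auto
  with uv have "u < k - 1 \<or> v < k - 1" by linarith
  with uv obtain j where j: "j < k - 1" "\<bar>x j\<bar> = 1" by fastforce
  have "Max ((\<lambda>i. \<bar>x i\<bar>) ` {..<k - 1}) = 1"
  proof (rule Max_eqI)
    have "\<bar>x i\<bar> \<le> 1" if "i < k - 1" for i
    proof -
      have "x i \<in> {-1, 0, 1}" using x that by (simp add: balanced_def)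
      then show ?thesis by auto
    qed
    then show "y \<le> 1" if "y \<in> (\<lambda>i. \<bar>x i\<bar>) ` {..<k - 1}" for y using that by auto
    show "1 \<in> (\<lambda>i. \<bar>x i\<bar>) ` {..<k - 1}"
      using j by (intro image_eqI[of _ _ j]) auto
  qed simp
  moreover have "(\<lambda>i. \<bar>vec (k - 1) x $ i\<bar>) ` {..<k - 1} = (\<lambda>i. \<bar>x i\<bar>) ` {..<k - 1}"
    by (rule image_cong) auto
  ultimately show "pnorm \<infinity> (vec (k - 1) (\<lambda>j. \<Sum>i<k. (if i = j then 1 else 0) * x i)) = 1"
    unfolding vec pnorm_def dim_vec by (simp only: if_True simp_thms)
qed (use k in auto)

lemma phi_cover_finite:
  fixes q :: real
  assumes G: "fin_mgraph G" and k: "k \<ge> 2" and l: "l \<ge> 1" and C: "oriented_cycle_cover G k l C"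
    and q: "q \<ge> 1"
  shows "phi (k - 1) (ereal q) G = 2"
proof -
  \<comment> \<open>The guard \<open>2 * l \<le> k\<close> is kept because it is derived from a
    balanced vector, and \<open>G\<close> may have no edges to provide one.\<close>
  obtain c where c: "2 * l \<le> k \<longrightarrow> (real l - 1) * \<bar>1 + c\<bar> powr q + real l * \<bar>1 - c\<bar> powr q
      + (real k - 2 * real l) * \<bar>c\<bar> powr q = 2 * real l"
    using shift_exists[OF q l, of k] by blast
  define m where "m = k - 1"
  then have k_eq: "k = Suc m" using k by simp
  \<comment> \<open>Unscaled, the images will have q-norm (2l)^(1/q); \<open>s\<close> is its
    inverse.\<close>
  define s where "s = (2 * real l) powr (- 1 / q)"
  have "s powr q = (2 * real l) powr (-1)"
    using q by (simp only: s_def powr_powr) simp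
  then have s: "s > 0" "s powr q = 1 / (2 * real l)"
    using l by (auto simp: s_def powr_minus_divide)
  let ?a = "\<lambda>j i. s * ((if i = j then 1 else 0) + (if i = m then c else 0))"
  show ?thesis
  proof (rule phi_eq_2[OF G C, where a = ?a])
    fix x assume x: "balanced k l x"
    have "(\<Sum>i<k. ?a j i * x i) = s * (x j + c * x m)" if "j < m" for j
    proof -
      have "(\<Sum>i<k. ?a j i * x i) = s * (\<Sum>i<k. (if i = j then x i else 0) + (if i = m then c * x i else 0))"
        unfolding sum_distrib_left by (intro sum.cong) (auto simp: algebra_simps)
      then show ?thesis using that by (simp add: sum.distrib k_eq del: sum.lessThan_Suc)
    qed
    then have vec: "vec (k - 1) (\<lambda>j. \<Sum>i<k. ?a j i * x i) = vec m (\<lambda>j. s * (x j + c * x m))"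
      by (intro eq_vecI) (auto simp: m_def)
    \<comment> \<open>The summand for the last coordinate is added and subtracted so that
      \<open>balanced_sum\<close> applies.\<close>
    have "(\<Sum>j<m. \<bar>x j + c * x m\<bar> powr q) = (\<Sum>j<k. \<bar>x j + c * x m\<bar> powr q) - \<bar>x m + c * x m\<bar> powr q"
      by (simp add: k_eq)
    also have "\<dots> = real l * \<bar>1 + c * x m\<bar> powr q + real l * \<bar>-1 + c * x m\<bar> powr q
        + (real k - 2 * real l) * \<bar>c * x m\<bar> powr q - \<bar>x m + c * x m\<bar> powr q"
      using balanced_sum[OF x, of "\<lambda>y. \<bar>y + c * x m\<bar> powr q"] by simp
    also have "\<dots> = 2 * real l"
    proof -
      \<comment> \<open>For last entry 0, c drops out and 2l entries contribute 1 each. For 1 the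
        claim is the equation defining \<open>c\<close>, and for -1 a global change of sign leads to
        the same equation.\<close>
      have "x m = 0 \<or> x m = 1 \<or> x m = -1" using x by (auto simp: balanced_def k_eq)
      moreover have "\<bar>-1 - c\<bar> = \<bar>1 + c\<bar>" "\<bar>-c - 1\<bar> = \<bar>1 + c\<bar>" "\<bar>-1 + c\<bar> = \<bar>1 - c\<bar>" by auto
      ultimately show ?thesis
        using c balanced_le[OF x] by (auto simp: algebra_simps)
    qed
    finally have "(\<Sum>j<m. \<bar>s * (x j + c * x m)\<bar> powr q) = s powr q * (2 * real l)"
      using s(1) by (simp add: abs_mult powr_mult flip: sum_distrib_left)
    also have "\<dots> = 1" using s l by simp
    finally show "pnorm (ereal q) (vec (k - 1) (\<lambda>j. \<Sum>i<k. ?a j i * x i)) = 1"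
      unfolding vec pnorm_def by simp
  qed (use k q in \<open>auto simp: one_ereal_def\<close>)
qed

section \<open>Oriented double covers and the 1-norm\<close>

lemma phi_double_cover:
  assumes G: "fin_mgraph G" and k: "k \<ge> 2" and C: "oriented_cycle_cover G k 1 C"
  shows "phi (nat \<lceil>real k / 2\<rceil>) 1 G = 2"
proof -
  define m where "m = nat \<lceil>real k / 2\<rceil>"
  have m: "m \<ge> 1" "k \<le> 2 * m"
    using k unfolding m_def by linarith+
  \<comment> \<open>The columns are distinct vertices of the cross-polytope scaled by 1/2, which
    makes their mutual 1-distance 1 instead of 2. Its 2m vertices suffice as k \<le> 2m.\<close>
  let ?a = "\<lambda>j i. (if i div 2 = j then if even i then 1/2 else -1/2 else 0) :: real"
  have "phi m 1 G = 2"
  proof (rule phi_eq_2[OF G C, where a = ?a])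
    fix x assume x: "balanced k 1 x"
    then obtain u v where u: "{i. i < k \<and> x i = 1} = {u}" and v: "{i. i < k \<and> x i = -1} = {v}"
      by (auto simp: balanced_def card_1_singleton_iff)
    have "u \<in> {i. i < k \<and> x i = 1}" "v \<in> {i. i < k \<and> x i = -1}" unfolding u v by simp_all
    then have uv: "u < k" "v < k" "x u = 1" "x v = -1" "u \<noteq> v" by auto
    have xi: "x i = (if i = u then 1 else 0) - (if i = v then 1 else 0)" if "i < k" for i
    proof -
      have "x i = 1 \<longleftrightarrow> i = u" "x i = -1 \<longleftrightarrow> i = v" using u v that by blast+
      moreover have "x i \<in> {-1, 0, 1}" using x that by (simp add: balanced_def)
      ultimately show ?thesis using uv by auto
    qed
    have lin: "(\<Sum>i<k. ?a j i * x i) = ?a j u - ?a j v" for j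
    proof -
      have "(\<Sum>i<k. ?a j i * x i) = (\<Sum>i<k. (if i = u then ?a j i else 0) - (if i = v then ?a j i else 0))"
        by (rule sum.cong) (simp_all add: xi)
      then show ?thesis using uv by (simp add: sum_subtractf)
    qed
    have b: "u div 2 < m" "v div 2 < m" using uv m by auto
    have "(\<Sum>j<m. \<bar>?a j u - ?a j v\<bar>) = 1"
    \<comment> \<open>Antipodal vertices differ by 1 in a single coordinate; vertices on different
      axes differ by 1/2 in two coordinates.\<close>
    proof (cases "u div 2 = v div 2")
      case True
      then have "even u \<noteq> even v" using \<open>u \<noteq> v\<close> by presburger
      then have "(\<Sum>j<m. \<bar>?a j u - ?a j v\<bar>) = (\<Sum>j<m. if v div 2 = j then 1 else 0)"
        using True by (intro sum.cong) auto
      then show ?thesis using b by simp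
    next
      case False
      then have "(\<Sum>j<m. \<bar>?a j u - ?a j v\<bar>)
          = (\<Sum>j<m. (if u div 2 = j then 1/2 else 0) + (if v div 2 = j then 1/2 else 0))"
        by (intro sum.cong) auto
      then show ?thesis using b by (simp add: sum.distrib)
    qed
    then show "pnorm 1 (vec m (\<lambda>j. \<Sum>i<k. ?a j i * x i)) = 1"
      unfolding lin pnorm_def by simp
  qed (use m in auto)
  then show ?thesis by (simp add: m_def)
qed

theorem theorem1p10:
  fixes G :: "('v, 'e) mgraph" and k l :: nat
  assumes "fin_mgraph G"
    and "k \<ge> 2" and "l \<ge> 1"
    and "admits_oriented_cycle_cover G k l"
  shows "(\<forall>p::ereal. 1 \<le> p \<longrightarrow> phi (k - 1) p G = 2) \<and>
    (l = 1 \<longrightarrow> phi (nat \<lceil>real k / 2\<rceil>) 1 G = 2)"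
proof (intro conjI allI impI)
  obtain C where C: "oriented_cycle_cover G k l C"
    using assms(4) by (auto simp: admits_oriented_cycle_cover_def)
  show "phi (k - 1) p G = 2" if "1 \<le> p" for p :: ereal
  proof (cases p)
    case (real q)
    then show ?thesis using phi_cover_finite[OF assms(1-3) C, of q] that by simp
  next
    case PInf
    then show ?thesis using phi_cover_top[OF assms(1-3) C] by simp
  qed (use that in auto)
  show "phi (nat \<lceil>real k / 2\<rceil>) 1 G = 2" if "l = 1"
    using phi_double_cover[OF assms(1,2)] C that by simp
qed

end
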